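(* Let $M>0$, $\mu\in(0,2]$, $T\ge1$, $\delta\in(0,1)$, and let $\mathcal F=\{f_1,\ldots,f_K\}$ be a finite class of real-valued functions on $\mathcal X$. Suppose that $|f(X)|\le\tfrac12M$ almost surely for all $f\in\mathcal F$, that $|\partial_y\ell(y,Y)|\le M$ almost surely for all $y$ with $|y|\le\tfrac12M$, and that $\ell$ is $\mu$-strongly convex in its first argument. Let $p_1,\ldots,p_T$ be the distributions produced by Algorithm 1 (defined in the context) run for $T$ rounds with inputs $\eta=\frac\mu4$ and $M$, expert predictions $y_t(i)=f_i(X_t)$ and feedback $g_t=\ell_t'(\hat y_t)$, and let $\hat f=\frac1T\sum_{t=1}^T\sum_{i=1}^Kp_t(i)f_i$. Then, with probability at least $1-\delta$, $$R(\hat f)-\min_{f\in\mathcal F}R(f)\le\frac1T\left(\frac{4M^2\log K}{\mu}+\log(1/\delta)\,\min\left\{\frac{1}{(2+\frac\mu2)M^2},\ \frac{\mu}{6M^2}\Big(1+\frac{\mu^2}{16}\Big)^{-1}\right\}^{-1}\right).$$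
   Context: Setting: $(X_t,Y_t)_{t=1}^T$ are i.i.d. copies of $(X,Y)\sim\mathbb P$ on $\mathcal X\times\mathbb R$; $\ell:\mathbb R^2\to\mathbb R$ is a loss, differentiable in its first argument; the risk of $f:\mathcal X\to\mathbb R$ is $R(f)=\mathbb E\,\ell(f(X),Y)$, where for data-dependent $\hat f$ the expectation is over an independent pair $(X,Y)$. "$\mu$-strongly convex in its first argument" means $\ell(y,Y)-\ell(x,Y)\le(y-x)\partial_y\ell(y,Y)-\frac\mu2(x-y)^2$ for all $x,y\in[-\tfrac12M,\tfrac12M]$. Write $\ell_t(\cdot)=\ell(\cdot,Y_t)$. $\log$ is the natural logarithm. Algorithm 1 (with $\kappa_t\equiv1$; inputs $\eta$, $M$): set $\gamma=\eta/M^2$, $p_1(i)=1/K$. In round $t$: receive expert predictions $y_t(1),\ldots,y_t(K)$; predict $\hat y_t=\sum_{i=1}^Kp_t(i)y_t(i)$; receive $g_t$; set $\tilde\ell_t(i)=\gamma(y_t(i)-\hat y_t)g_t+\big(\gamma(y_t(i)-\hat y_t)g_t\big)^2$; set $p_{t+1}(i)\propto\exp\!\big(-\sum_{s=1}^t\tilde\ell_s(i)\big)$, normalized to sum to one. (In the paper this procedure is the early-stopping online to batch conversion with stopping threshold $\mathcal S=\infty$, i.e. without early stopping.) *)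

theory Defs
  imports "HOL-Probability.Probability"
begin

text \<open>
  The loss \<^term>\<open>l\<close> takes the prediction first and the outcome second.  The risk is an integral
  over the law \<^term>\<open>P\<close> of a fresh pair, so for a data-dependent predictor the data are held
  fixed.  A Bochner integral of a non-integrable function is 0.  If the derivative of the loss
  is bounded by M, the losses of two predictors with values in [-M/2, M/2] differ by at most M^2,
  so either all of them are integrable or none is.
\<close>

definition risk :: "('x \<times> real) measure \<Rightarrow> (real \<Rightarrow> real \<Rightarrow> real) \<Rightarrow> ('x \<Rightarrow> real) \<Rightarrow> real" where
  "risk P l h = (\<integral>z. l (h (fst z)) (snd z) \<partial>P)"

definition strongly_convex :: "real \<Rightarrow> real \<Rightarrow> (real \<Rightarrow> real) \<Rightarrow> bool" where
  "strongly_convex \<mu> M \<phi> \<longleftrightarrow>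
     (\<forall>x\<in>{-M/2..M/2}. \<forall>y\<in>{-M/2..M/2}.
        \<phi> y - \<phi> x \<le> (y - x) * deriv \<phi> y - \<mu> / 2 * (x - y)\<^sup>2)"

text \<open>
  Experts are numbered \<^term>\<open>{1..K}\<close> and rounds start at 1.  The prediction of expert i in
  round t is \<^term>\<open>y t i\<close>.  The feedback may depend on the learner's prediction, so it is given
  as a function: \<^term>\<open>g t a\<close> is what is received in round t after predicting \<^term>\<open>a\<close>.
\<close>

definition exp_weights :: "nat \<Rightarrow> (nat \<Rightarrow> real) \<Rightarrow> nat \<Rightarrow> real" where
  "exp_weights K L i = exp (- L i) / (\<Sum>j=1..K. exp (- L j))"

definition mixture :: "nat \<Rightarrow> (nat \<Rightarrow> real) \<Rightarrow> (nat \<Rightarrow> real) \<Rightarrow> real" where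
  "mixture K p y = (\<Sum>i=1..K. p i * y i)"

definition surrogate_loss :: "real \<Rightarrow> real \<Rightarrow> real \<Rightarrow> real \<Rightarrow> real \<Rightarrow> real" where
  "surrogate_loss \<eta> M y yhat g =
     (let \<gamma> = \<eta> / M\<^sup>2 in \<gamma> * (y - yhat) * g + (\<gamma> * (y - yhat) * g)\<^sup>2)"

primrec cum_loss ::
  "real \<Rightarrow> real \<Rightarrow> nat \<Rightarrow> (nat \<Rightarrow> nat \<Rightarrow> real) \<Rightarrow> (nat \<Rightarrow> real \<Rightarrow> real) \<Rightarrow> nat \<Rightarrow> nat \<Rightarrow> real" where
  "cum_loss \<eta> M K y g 0 = (\<lambda>i. 0)"
| "cum_loss \<eta> M K y g (Suc t) =
     (let yhat = mixture K (exp_weights K (cum_loss \<eta> M K y g t)) (y (Suc t))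
      in (\<lambda>i. cum_loss \<eta> M K y g t i
             + surrogate_loss \<eta> M (y (Suc t) i) yhat (g (Suc t) yhat)))"

definition alg_weights ::
  "real \<Rightarrow> real \<Rightarrow> nat \<Rightarrow> (nat \<Rightarrow> nat \<Rightarrow> real) \<Rightarrow> (nat \<Rightarrow> real \<Rightarrow> real) \<Rightarrow> nat \<Rightarrow> nat \<Rightarrow> real" where
  "alg_weights \<eta> M K y g t = exp_weights K (cum_loss \<eta> M K y g (t - 1))"

definition alg_prediction ::
  "real \<Rightarrow> real \<Rightarrow> nat \<Rightarrow> (nat \<Rightarrow> nat \<Rightarrow> real) \<Rightarrow> (nat \<Rightarrow> real \<Rightarrow> real) \<Rightarrow> nat \<Rightarrow> real" where
  "alg_prediction \<eta> M K y g t = mixture K (alg_weights \<eta> M K y g t) (y t)"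

lemma alg_weights_1: "alg_weights \<eta> M K y g 1 i = 1 / real K"
  by (simp add: alg_weights_def exp_weights_def)

lemma cum_loss_eq_sum:
  "cum_loss \<eta> M K y g t i =
     (\<Sum>s=1..t. surrogate_loss \<eta> M (y s i) (alg_prediction \<eta> M K y g s)
                 (g s (alg_prediction \<eta> M K y g s)))"
  by (induction t) (simp_all add: Let_def alg_prediction_def alg_weights_def)

lemma alg_weights_Suc:
  "alg_weights \<eta> M K y g (Suc t) i =
     exp (- cum_loss \<eta> M K y g t i) / (\<Sum>j=1..K. exp (- cum_loss \<eta> M K y g t j))"
  by (simp add: alg_weights_def exp_weights_def)

definition averaged_predictor ::
  "nat \<Rightarrow> nat \<Rightarrow> (nat \<Rightarrow> nat \<Rightarrow> real) \<Rightarrow> (nat \<Rightarrow> 'x \<Rightarrow> real) \<Rightarrow> 'x \<Rightarrow> real" where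
  "averaged_predictor T K p f x = 1 / real T * (\<Sum>t=1..T. \<Sum>i=1..K. p t i * f i x)"

end

theory Submission
  imports Defs
begin

text \<open>
  Let \<open>D\<^sub>t\<close> be the difference in round \<open>t\<close> between the predictions of the learner and of the
  best expert.  The second-order surrogate loss makes the linearized regret at most
  \<open>4 M\<^sup>2 ln K / \<mu> + (\<mu> / 4) \<Sum> D\<^sub>t\<^sup>2\<close>, while strong convexity subtracts \<open>(\<mu> / 2) \<Sum> D\<^sub>t\<^sup>2\<close>.
  The remaining negative term \<open>- (\<mu> / 4) \<Sum> D\<^sub>t\<^sup>2\<close> pays for the conversion to risk: the loss gap
  in round \<open>t\<close> is at most \<open>M \<bar>D\<^sub>t\<bar>\<close>, so its variance is absorbed, and the exponential of \<open>\<lambda>\<close> times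
  (expected gap - gap - \<open>(\<mu> / 4) D\<^sub>t\<^sup>2\<close>) has conditional mean at most 1 when \<open>\<lambda>\<close> is the minimum in
  the theorem.  Markov's inequality for the product over the rounds and Jensen's inequality
  for the averaged predictor finish the proof.
\<close>

section \<open>Scalar bounds for the exponential\<close>

text \<open>The right side minus the left has derivative \<open>1 + 3/2 * x - exp x\<close>, which
  has the sign of \<open>x\<close> on [-1/2, 1/2], so its minimum is at 0. The coefficient 3/4
  matches the range: up to 1/2, \<open>x\<^sup>2 \<le> x / 2\<close> turns
  \<open>exp x \<le> 1 + x + x\<^sup>2\<close> into \<open>exp x \<le> 1 + 3/2 * x\<close>.\<close>

lemma exp_le_quadratic:
  fixes v :: real
  assumes "\<bar>v\<bar> \<le> 1/2"
  shows "exp v \<le> 1 + v + 3/4 * v\<^sup>2"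
proof -
  define h where "h = (\<lambda>x::real. 1 + x + 3/4 * x\<^sup>2 - exp x)"
  have deriv_h: "(h has_real_derivative (1 + 3/2 * x - exp x)) (at x)" for x
    unfolding h_def by (auto intro!: derivative_eq_intros)
  have "h 0 \<le> h v"
  proof (cases "v \<ge> 0")
    case True
    show ?thesis
    proof (rule DERIV_nonneg_imp_nondecreasing[OF True])
      fix x assume x: "0 \<le> x" "x \<le> v"
      have "exp x \<le> 1 + x + x\<^sup>2" using x assms by (intro exp_bound) auto
      moreover have "x\<^sup>2 \<le> x * (1/2)"
        unfolding power2_eq_square using x assms by (intro mult_left_mono) auto
      ultimately show "\<exists>y. DERIV h x :> y \<and> 0 \<le> y"
        using deriv_h[of x] by (intro exI[of _ "1 + 3/2 * x - exp x"]) auto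
    qed
  next
    case False
    show ?thesis
    proof (rule DERIV_nonpos_imp_nonincreasing[where f = h])
      show "v \<le> 0" using False by simp
      fix x assume x: "v \<le> x" "x \<le> 0"
      have "1 + 3/2 * x - exp x \<le> 0" using exp_ge_add_one_self[of x] x by linarith
      then show "\<exists>y. DERIV h x :> y \<and> y \<le> 0" using deriv_h by blast
    qed
  qed
  then show ?thesis by (simp add: h_def)
qed

text \<open>After taking logarithms, \<open>ln (1 - x) + x + x\<^sup>2\<close> has derivative
  \<open>x * (1 - 2 * x) / (1 - x)\<close>, whose sign is that of \<open>x\<close> up to 1/2, so the
  minimum is again at the origin.\<close>

lemma exp_minus_minus_square_le:
  fixes z :: real
  assumes "\<bar>z\<bar> \<le> 1/2"
  shows "exp (- (z + z\<^sup>2)) \<le> 1 - z"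
proof -
  define h where "h = (\<lambda>x::real. ln (1 - x) + x + x\<^sup>2)"
  have deriv_h: "(h has_real_derivative (x * (1 - 2 * x) / (1 - x))) (at x)" if "x < 1" for x
    unfolding h_def using that
    by (auto intro!: derivative_eq_intros simp: field_simps power2_eq_square)
  have "h 0 \<le> h z"
  proof (cases "z \<ge> 0")
    case True
    show ?thesis
    proof (rule DERIV_nonneg_imp_nondecreasing[OF True])
      fix x assume "0 \<le> x" "x \<le> z"
      then show "\<exists>y. DERIV h x :> y \<and> 0 \<le> y"
        using assms deriv_h[of x]
        by (intro exI[of _ "x * (1 - 2 * x) / (1 - x)"]) (auto intro!: divide_nonneg_nonneg mult_nonneg_nonneg)
    qed
  next
    case False
    show ?thesis
    proof (rule DERIV_nonpos_imp_nonincreasing[where f = h])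
      show "z \<le> 0" using False by simp
      fix x assume "z \<le> x" "x \<le> 0"
      then show "\<exists>y. DERIV h x :> y \<and> y \<le> 0"
        using deriv_h[of x]
        by (intro exI[of _ "x * (1 - 2 * x) / (1 - x)"]) (auto intro!: divide_nonpos_nonneg mult_nonpos_nonneg)
    qed
  qed
  then have "- (z + z\<^sup>2) \<le> ln (1 - z)" by (simp add: h_def)
  then show ?thesis using assms by (simp add: ln_ge_iff)
qed

section \<open>Consequences of strong convexity\<close>

lemma strongly_convexD:
  assumes "strongly_convex \<mu> M \<phi>" "\<bar>x\<bar> \<le> M/2" "\<bar>y\<bar> \<le> M/2"
  shows "\<phi> y - \<phi> x \<le> (y - x) * deriv \<phi> y - \<mu> / 2 * (x - y)\<^sup>2"
proof -
  have "x \<in> {-M/2..M/2}" "y \<in> {-M/2..M/2}" using assms(2,3) by (auto simp: abs_if split: if_splits)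
  then show ?thesis using assms(1) unfolding strongly_convex_def by blast
qed

text \<open>The tangent inequality at \<open>y\<close> bounds \<open>\<phi> y - \<phi> x\<close> by
  the slope at \<open>y\<close>; exchanging the two points bounds the opposite difference.\<close>

lemma strongly_convex_lipschitz:
  assumes "strongly_convex \<mu> M \<phi>" "0 \<le> \<mu>" "\<And>y. \<bar>y\<bar> \<le> M/2 \<Longrightarrow> \<bar>deriv \<phi> y\<bar> \<le> L"
    and "\<bar>u\<bar> \<le> M/2" "\<bar>v\<bar> \<le> M/2"
  shows "\<bar>\<phi> u - \<phi> v\<bar> \<le> L * \<bar>u - v\<bar>"
proof -
  have *: "\<phi> y - \<phi> x \<le> L * \<bar>y - x\<bar>" if "\<bar>x\<bar> \<le> M/2" "\<bar>y\<bar> \<le> M/2" for x y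
  proof -
    have "\<phi> y - \<phi> x \<le> (y - x) * deriv \<phi> y - \<mu> / 2 * (x - y)\<^sup>2"
      using assms(1) that by (rule strongly_convexD)
    also have "\<dots> \<le> (y - x) * deriv \<phi> y" using assms(2) by simp
    also have "\<dots> \<le> \<bar>y - x\<bar> * \<bar>deriv \<phi> y\<bar>" by (metis abs_ge_self abs_mult)
    also have "\<dots> \<le> \<bar>y - x\<bar> * L" using assms(3)[OF that(2)] by (intro mult_left_mono) auto
    finally show ?thesis by (simp add: mult.commute)
  qed
  show ?thesis using *[OF assms(4,5)] *[OF assms(5,4)] by (simp add: abs_le_iff abs_minus_commute)
qed

text \<open>The tangent inequalities at the mean are added; their linear terms cancel because the
  deviations from the mean sum to zero. This is Jensen's inequality on the interval where convexity
  is assumed.\<close>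

lemma strongly_convex_average_le:
  assumes "strongly_convex \<mu> M \<phi>" "0 \<le> \<mu>" "(T::nat) \<ge> 1"
    and x: "\<And>t. t \<in> {1..T} \<Longrightarrow> \<bar>x t\<bar> \<le> M/2" and avg: "\<bar>1 / real T * (\<Sum>t=1..T. x t)\<bar> \<le> M/2"
  shows "\<phi> (1 / real T * (\<Sum>t=1..T. x t)) \<le> 1 / real T * (\<Sum>t=1..T. \<phi> (x t))"
proof -
  define m where "m = 1 / real T * (\<Sum>t=1..T. x t)"
  have "\<phi> m - \<phi> (x t) \<le> (m - x t) * deriv \<phi> m" if "t \<in> {1..T}" for t
  proof -
    have "\<phi> m - \<phi> (x t) \<le> (m - x t) * deriv \<phi> m - \<mu> / 2 * (x t - m)\<^sup>2"
      using assms(1) x[OF that] avg[folded m_def] by (rule strongly_convexD)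
    also have "\<dots> \<le> (m - x t) * deriv \<phi> m" using assms(2) by simp
    finally show ?thesis .
  qed
  then have "(\<Sum>t=1..T. \<phi> m - \<phi> (x t)) \<le> (\<Sum>t=1..T. (m - x t) * deriv \<phi> m)"
    by (intro sum_mono) auto
  also have "\<dots> = (real T * m - (\<Sum>t=1..T. x t)) * deriv \<phi> m"
    by (simp add: sum_distrib_right[symmetric] sum_subtractf)
  also have "\<dots> = 0" using assms(3) by (simp add: m_def)
  finally have "real T * \<phi> m \<le> (\<Sum>t=1..T. \<phi> (x t))" by (simp add: sum_subtractf)
  then show ?thesis using assms(3) unfolding m_def[symmetric] by (simp add: field_simps)
qed

section \<open>Probability vectors and mixtures of experts\<close>

definition prob_vec :: "nat \<Rightarrow> (nat \<Rightarrow> real) \<Rightarrow> bool" where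
  "prob_vec K q \<longleftrightarrow> (\<forall>i\<in>{1..K}. 0 \<le> q i) \<and> (\<Sum>i=1..K. q i) = 1"

lemma prob_vec_exp_weights:
  assumes "K \<ge> 1" shows "prob_vec K (exp_weights K L)"
proof -
  have "(\<Sum>j=1..K. exp (- L j)) > 0" using assms by (intro sum_pos) auto
  then show ?thesis
    by (auto simp: prob_vec_def exp_weights_def sum_divide_distrib[symmetric] intro!: divide_nonneg_pos)
qed

lemma prob_vec_average:
  assumes "(T::nat) \<ge> 1" "\<And>t. t \<in> {1..T} \<Longrightarrow> prob_vec K (q t)"
  shows "prob_vec K (\<lambda>i. 1 / real T * (\<Sum>t=1..T. q t i))"
proof -
  have "(\<Sum>i=1..K. \<Sum>t=1..T. q t i) = (\<Sum>t=1..T. \<Sum>i=1..K. q t i)" by (rule sum.swap)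
  also have "\<dots> = real T" using assms(2) by (simp add: prob_vec_def)
  finally have "(\<Sum>i=1..K. 1 / real T * (\<Sum>t=1..T. q t i)) = 1"
    using assms(1) by (simp add: sum_distrib_left[symmetric] sum_divide_distrib[symmetric])
  moreover have "0 \<le> 1 / real T * (\<Sum>t=1..T. q t i)" if "i \<in> {1..K}" for i
    using assms(2) that by (intro mult_nonneg_nonneg sum_nonneg) (auto simp: prob_vec_def)
  ultimately show ?thesis by (simp add: prob_vec_def)
qed

text \<open>A single expert is a mixture with unit weights, so the learner, the averaged predictor
  and the competitor all fall under the same lemmas.\<close>

lemma prob_vec_unit: "i \<in> {1..K} \<Longrightarrow> prob_vec K (\<lambda>j. if j = i then 1 else 0)"
  by (simp add: prob_vec_def)

lemma mixture_unit: "i \<in> {1..K} \<Longrightarrow> mixture K (\<lambda>j. if j = i then 1 else 0) y = y i"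
  by (simp add: mixture_def if_distrib[of "\<lambda>c. c * _"] cong: if_cong)

lemma abs_mixture_le:
  assumes "prob_vec K q" "\<And>i. i \<in> {1..K} \<Longrightarrow> \<bar>y i\<bar> \<le> B"
  shows "\<bar>mixture K q y\<bar> \<le> B"
proof -
  have "\<bar>mixture K q y\<bar> \<le> (\<Sum>i=1..K. \<bar>q i * y i\<bar>)" unfolding mixture_def by (rule sum_abs)
  also have "\<dots> \<le> (\<Sum>i=1..K. q i * B)"
    using assms by (intro sum_mono) (auto simp: prob_vec_def abs_mult intro!: mult_left_mono)
  also have "\<dots> = B" using assms(1) by (simp add: prob_vec_def sum_distrib_right[symmetric])
  finally show ?thesis .
qed

text \<open>Averaging over rounds commutes with mixing experts. Hence the averaged predictor is
  described by one weight vector, like the prediction of a single round.\<close>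

lemma averaged_predictor_eq_mixture:
  "averaged_predictor T K p f x = mixture K (\<lambda>i. 1 / real T * (\<Sum>t=1..T. p t i)) (\<lambda>i. f i x)"
proof -
  have "(\<Sum>t=1..T. \<Sum>i=1..K. p t i * f i x) = (\<Sum>i=1..K. (\<Sum>t=1..T. p t i) * f i x)"
    unfolding sum_distrib_right by (rule sum.swap)
  then show ?thesis
    by (simp add: averaged_predictor_def mixture_def sum_distrib_left[symmetric] sum_divide_distrib[symmetric])
qed

lemma mixture_average:
  "mixture K (\<lambda>i. 1 / real T * (\<Sum>t=1..T. q t i)) y = 1 / real T * (\<Sum>t=1..T. mixture K (q t) y)"
  \<comment> \<open>The predictions here depend on no point, so the point is the dummy
    \<open>()\<close>.\<close>
  using averaged_predictor_eq_mixture[of T K q "\<lambda>i _. y i" "()"]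
  by (simp add: averaged_predictor_def mixture_def)

section \<open>Regret of the second-order exponential weights\<close>

lemma prob_vec_alg_weights: "K \<ge> 1 \<Longrightarrow> prob_vec K (alg_weights \<eta> M K y g t)"
  by (simp add: alg_weights_def prob_vec_exp_weights)

lemma cum_loss_cong:
  assumes "\<And>s. s \<in> {1..t} \<Longrightarrow> y s = y' s" "\<And>s. s \<in> {1..t} \<Longrightarrow> g s = g' s"
  shows "cum_loss \<eta> M K y g t = cum_loss \<eta> M K y' g' t"
  using assms by (induction t) (simp_all add: Let_def)

text \<open>The algorithm is causal: its weights in round \<open>t\<close> see only strictly earlier
  rounds. This is what allows the newest data point to be integrated out with the weights held
  fixed.\<close>

lemma alg_weights_cong:
  assumes "\<And>s. s \<in> {1..<t} \<Longrightarrow> y s = y' s" "\<And>s. s \<in> {1..<t} \<Longrightarrow> g s = g' s"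
  shows "alg_weights \<eta> M K y g t = alg_weights \<eta> M K y' g' t"
  unfolding alg_weights_def
  by (rule arg_cong[of _ _ "exp_weights K"], rule cum_loss_cong) (use assms in auto)

text \<open>
  The surrogate loss is designed so that the potential never grows: \<open>exp (- (z + z\<^sup>2)) \<le> 1 - z\<close>,
  and the terms linear in \<open>z\<close> average to 0 under the current weights.
\<close>

lemma sum_exp_cum_loss_le:
  assumes "K \<ge> 1"
    and small: "\<And>s i. s \<in> {1..t} \<Longrightarrow> i \<in> {1..K} \<Longrightarrow>
       \<bar>\<eta> / M\<^sup>2 * (y s i - alg_prediction \<eta> M K y g s) * g s (alg_prediction \<eta> M K y g s)\<bar> \<le> 1/2"
  shows "(\<Sum>i=1..K. exp (- cum_loss \<eta> M K y g t i)) \<le> K"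
  using small
proof (induction t)
  case 0
  then show ?case by simp
next
  case (Suc t)
  define L where "L = cum_loss \<eta> M K y g t"
  define q where "q = exp_weights K L"
  define a where "a = alg_prediction \<eta> M K y g (Suc t)"
  define z where "z = (\<lambda>i. \<eta> / M\<^sup>2 * (y (Suc t) i - a) * g (Suc t) a)"
  define W where "W = (\<Sum>i=1..K. exp (- L i))"
  have a: "a = mixture K q (y (Suc t))"
    by (simp add: a_def q_def L_def alg_prediction_def alg_weights_def)
  have W: "W > 0" unfolding W_def using assms(1) by (intro sum_pos) auto
  have q: "prob_vec K q" unfolding q_def using assms(1) by (rule prob_vec_exp_weights)
  have exp_L: "exp (- L i) = W * q i" for i using W by (simp add: q_def exp_weights_def W_def)
  have cl: "cum_loss \<eta> M K y g (Suc t) i = L i + (z i + (z i)\<^sup>2)" for i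
    by (simp add: Let_def L_def[symmetric] q_def[symmetric] a[symmetric] surrogate_loss_def z_def)
  have "(\<Sum>i=1..K. q i * z i) = \<eta> / M\<^sup>2 * g (Suc t) a * (\<Sum>i=1..K. q i * (y (Suc t) i - a))"
    unfolding sum_distrib_left by (intro sum.cong) (auto simp: z_def algebra_simps)
  also have "(\<Sum>i=1..K. q i * (y (Suc t) i - a)) = mixture K q (y (Suc t)) - (\<Sum>i=1..K. q i) * a"
    by (simp add: mixture_def right_diff_distrib sum_subtractf sum_distrib_right)
  also have "\<dots> = 0" using q by (simp add: prob_vec_def a)
  finally have qz: "(\<Sum>i=1..K. q i * z i) = 0" by simp
  have "(\<Sum>i=1..K. exp (- cum_loss \<eta> M K y g (Suc t) i)) = (\<Sum>i=1..K. W * q i * exp (- (z i + (z i)\<^sup>2)))"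
    by (intro sum.cong refl) (simp only: cl exp_L[symmetric] exp_add[symmetric], simp)
  also have "\<dots> \<le> (\<Sum>i=1..K. W * q i * (1 - z i))"
  proof (intro sum_mono mult_left_mono exp_minus_minus_square_le)
    fix i assume i: "i \<in> {1..K}"
    show "\<bar>z i\<bar> \<le> 1/2" using Suc.prems[of "Suc t" i] i by (simp add: z_def a_def)
    show "0 \<le> W * q i" using W q i by (simp add: prob_vec_def)
  qed
  also have "\<dots> = W * ((\<Sum>i=1..K. q i) - (\<Sum>i=1..K. q i * z i))"
    by (simp add: right_diff_distrib sum_subtractf sum_distrib_left mult.assoc)
  also have "\<dots> = W" using q qz by (simp add: prob_vec_def)
  also have "W \<le> K" unfolding W_def L_def using Suc.prems by (intro Suc.IH) auto
  finally show ?case .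
qed

text \<open>The term of expert \<open>i\<close> alone is below the potential, hence its cumulative
  loss is at least \<open>- ln K\<close>. That loss is \<open>- \<gamma>\<close> times the
  linearized regret plus the sum of squares, and bounding the squared feedback by
  \<open>M\<^sup>2\<close> leaves \<open>\<gamma> * \<eta>\<close> in front of the squared
  differences; dividing by \<open>\<gamma>\<close> gives the bound. The condition
  \<open>\<eta> \<le> 1/2\<close> keeps the scaled differences within the range of
  \<open>sum_exp_cum_loss_le\<close>.\<close>

lemma linear_regret_le:
  assumes K: "K \<ge> 1" and "0 < \<eta>" "\<eta> \<le> 1/2" "0 < M" and i: "i \<in> {1..K}"
    and y: "\<And>s j. s \<in> {1..t} \<Longrightarrow> j \<in> {1..K} \<Longrightarrow> \<bar>y s j\<bar> \<le> M/2"
    and g: "\<And>s a. s \<in> {1..t} \<Longrightarrow> \<bar>a\<bar> \<le> M/2 \<Longrightarrow> \<bar>g s a\<bar> \<le> M"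
  defines "a \<equiv> alg_prediction \<eta> M K y g"
  shows "(\<Sum>s=1..t. (a s - y s i) * g s (a s)) \<le> M\<^sup>2 * ln K / \<eta> + \<eta> * (\<Sum>s=1..t. (a s - y s i)\<^sup>2)"
proof -
  define \<gamma> where "\<gamma> = \<eta> / M\<^sup>2"
  have \<gamma>: "\<gamma> > 0" using assms by (simp add: \<gamma>_def)
  have a: "\<bar>a s\<bar> \<le> M/2" if "s \<in> {1..t}" for s
    unfolding a_def alg_prediction_def
    by (rule abs_mixture_le[OF prob_vec_alg_weights[OF K] y[OF that]])
  have ga: "\<bar>g s (a s)\<bar> \<le> M" if "s \<in> {1..t}" for s using g[OF that a[OF that]] .
  have "(\<Sum>j=1..K. exp (- cum_loss \<eta> M K y g t j)) \<le> K"
  proof (rule sum_exp_cum_loss_le[OF K])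
    fix s j assume s: "s \<in> {1..t}" and j: "j \<in> {1..K}"
    have "\<bar>y s j - a s\<bar> * \<bar>g s (a s)\<bar> \<le> M * M"
      using y[OF s j] a[OF s] ga[OF s] assms(4) by (intro mult_mono) auto
    then have "\<gamma> * (\<bar>y s j - a s\<bar> * \<bar>g s (a s)\<bar>) \<le> \<gamma> * (M * M)"
      using \<gamma> by (intro mult_left_mono) auto
    also have "\<dots> \<le> 1/2" using assms by (simp add: \<gamma>_def power2_eq_square)
    finally show "\<bar>\<eta> / M\<^sup>2 * (y s j - alg_prediction \<eta> M K y g s) * g s (alg_prediction \<eta> M K y g s)\<bar> \<le> 1/2"
      using \<gamma> unfolding a_def[symmetric] \<gamma>_def[symmetric] by (simp add: abs_mult mult.assoc)
  qed
  moreover have "exp (- cum_loss \<eta> M K y g t i) \<le> (\<Sum>j=1..K. exp (- cum_loss \<eta> M K y g t j))"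
    using i by (intro member_le_sum) auto
  ultimately have "exp (- cum_loss \<eta> M K y g t i) \<le> K" by linarith
  then have "- cum_loss \<eta> M K y g t i \<le> ln K"
    using K by (simp add: ln_ge_iff)
  moreover have "cum_loss \<eta> M K y g t i =
      - \<gamma> * (\<Sum>s=1..t. (a s - y s i) * g s (a s)) + (\<Sum>s=1..t. (\<gamma> * (y s i - a s) * g s (a s))\<^sup>2)"
    unfolding cum_loss_eq_sum a_def[symmetric] surrogate_loss_def Let_def \<gamma>_def[symmetric]
      sum.distrib sum_distrib_left
    by (intro arg_cong2[of _ _ _ _ "(+)"] sum.cong) (auto simp: algebra_simps)
  moreover have "(\<Sum>s=1..t. (\<gamma> * (y s i - a s) * g s (a s))\<^sup>2) \<le> \<gamma> * \<eta> * (\<Sum>s=1..t. (a s - y s i)\<^sup>2)"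
    unfolding sum_distrib_left
  proof (intro sum_mono)
    fix s assume s: "s \<in> {1..t}"
    have "(g s (a s))\<^sup>2 \<le> M\<^sup>2" using ga[OF s] assms(4) by (simp add: abs_le_square_iff[symmetric])
    then have "(\<gamma>\<^sup>2 * (a s - y s i)\<^sup>2) * (g s (a s))\<^sup>2 \<le> (\<gamma>\<^sup>2 * (a s - y s i)\<^sup>2) * M\<^sup>2"
      by (intro mult_left_mono) auto
    also have "\<dots> = \<gamma> * \<eta> * (a s - y s i)\<^sup>2"
      using assms(4) by (simp add: \<gamma>_def power2_eq_square)
    finally show "(\<gamma> * (y s i - a s) * g s (a s))\<^sup>2 \<le> \<gamma> * \<eta> * (a s - y s i)\<^sup>2"
      by (simp add: power_mult_distrib power2_commute)
  qed
  ultimately have "\<gamma> * (\<Sum>s=1..t. (a s - y s i) * g s (a s)) \<le>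
      ln K + \<gamma> * \<eta> * (\<Sum>s=1..t. (a s - y s i)\<^sup>2)" by linarith
  also have "\<dots> = \<gamma> * (M\<^sup>2 * ln K / \<eta> + \<eta> * (\<Sum>s=1..t. (a s - y s i)\<^sup>2))"
    using assms by (simp add: \<gamma>_def field_simps)
  finally show ?thesis using \<gamma> by simp
qed

section \<open>Exponential inequality for one loss gap\<close>

text \<open>Each upper bound on \<open>lam\<close> has one task. The first gives
  \<open>lam * \<bar>V\<bar> \<le> 1/2\<close> for the corrected gap \<open>V\<close>, so that
  \<open>exp_le_quadratic\<close> applies. The second makes the quadratic term at most
  \<open>lam * (\<mu> / 4 * D\<^sup>2)\<close>, which the correction inside \<open>V\<close>
  cancels.\<close>

lemma exp_loss_gap_le:
  fixes lam W D M \<mu> :: real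
  assumes "M > 0" "\<mu> > 0" "lam > 0"
    and lam1: "lam \<le> 1 / ((2 + \<mu> / 2) * M\<^sup>2)"
    and lam2: "lam \<le> \<mu> / (6 * M\<^sup>2) * inverse (1 + \<mu>\<^sup>2 / 16)"
    and W: "\<bar>W\<bar> \<le> M * \<bar>D\<bar>" and D: "\<bar>D\<bar> \<le> M"
  shows "exp (- lam * (W + \<mu> / 4 * D\<^sup>2)) \<le> 1 - lam * W"
proof -
  define a where "a = \<mu> / 4"
  define V where "V = W + a * D\<^sup>2"
  have a: "a > 0" using assms by (simp add: a_def)
  have "a * D\<^sup>2 \<le> a * (M * \<bar>D\<bar>)"
    using mult_right_mono[OF D, of "\<bar>D\<bar>"] a by (intro mult_left_mono) (auto simp: power2_eq_square)
  moreover have "\<bar>V\<bar> \<le> \<bar>W\<bar> + a * D\<^sup>2"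
    using abs_triangle_ineq[of W "a * D\<^sup>2"] a by (simp add: V_def abs_mult)
  moreover have "(1 + a) * M * \<bar>D\<bar> = M * \<bar>D\<bar> + a * (M * \<bar>D\<bar>)" by (simp add: algebra_simps)
  ultimately have V: "\<bar>V\<bar> \<le> (1 + a) * M * \<bar>D\<bar>" using W by linarith
  also have "\<dots> \<le> (1 + a) * M * M" using D a assms(1) by (intro mult_left_mono) auto
  finally have "lam * \<bar>V\<bar> \<le> lam * ((1 + a) * M\<^sup>2)"
    using assms(3) by (intro mult_left_mono) (auto simp: power2_eq_square)
  also have "\<dots> \<le> 1/2"
  proof -
    have "(2 + \<mu> / 2) * M\<^sup>2 > 0" using assms(1,2) by (intro mult_pos_pos add_pos_pos) auto
    then have "lam * ((2 + \<mu> / 2) * M\<^sup>2) \<le> 1" using lam1 by (simp only: pos_le_divide_eq)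
    moreover have "(2 + \<mu> / 2) * M\<^sup>2 = 2 * ((1 + a) * M\<^sup>2)" by (simp add: a_def algebra_simps)
    ultimately show ?thesis by simp
  qed
  finally have "\<bar>- lam * V\<bar> \<le> 1/2" using assms(3) by (simp add: abs_mult)
  then have "exp (- lam * V) \<le> 1 + (- lam * V) + 3/4 * (- lam * V)\<^sup>2" by (rule exp_le_quadratic)
  moreover have "3/4 * (- lam * V)\<^sup>2 \<le> lam * (a * D\<^sup>2)"
  proof -
    have "V\<^sup>2 \<le> ((1 + a) * M * \<bar>D\<bar>)\<^sup>2" using power_mono[OF V, of 2] by simp
    also have "\<dots> = (1 + a)\<^sup>2 * (M\<^sup>2 * D\<^sup>2)" by (simp add: power_mult_distrib)
    \<comment> \<open>With \<open>a = \<mu> / 4\<close> this step produces the factor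
      \<open>1 + \<mu>\<^sup>2 / 16\<close> of the theorem.\<close>
    also have "\<dots> \<le> (2 * (1 + a\<^sup>2)) * (M\<^sup>2 * D\<^sup>2)"
    proof (rule mult_right_mono)
      have "2 * (1 + a\<^sup>2) - (1 + a)\<^sup>2 = (1 - a)\<^sup>2" by (simp add: power2_eq_square algebra_simps)
      then show "(1 + a)\<^sup>2 \<le> 2 * (1 + a\<^sup>2)" using zero_le_power2[of "1 - a"] by linarith
    qed simp
    finally have "3/4 * lam\<^sup>2 * V\<^sup>2 \<le> 3/4 * lam\<^sup>2 * ((2 * (1 + a\<^sup>2)) * (M\<^sup>2 * D\<^sup>2))"
      by (intro mult_left_mono) auto
    \<comment> \<open>The 6 arises as 4 * (3/4) * 2: the 3/4 is from
      \<open>exp_le_quadratic\<close>, the 2 from the previous step, and the 4 matches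
      \<open>4 * a = \<mu>\<close>.\<close>
    also have "\<dots> = 1/4 * lam * D\<^sup>2 * (lam * (6 * M\<^sup>2 * (1 + a\<^sup>2)))"
      by (simp add: power2_eq_square algebra_simps)
    also have "\<dots> \<le> 1/4 * lam * D\<^sup>2 * (4 * a)"
    proof (intro mult_left_mono)
      have "1 + a\<^sup>2 > 0" by (simp add: add_pos_nonneg)
      moreover have "lam \<le> 4 * a / (6 * M\<^sup>2 * (1 + a\<^sup>2))"
        using lam2 by (simp add: a_def power_divide inverse_eq_divide)
      ultimately show "lam * (6 * M\<^sup>2 * (1 + a\<^sup>2)) \<le> 4 * a"
        using assms(1) by (subst (asm) pos_le_divide_eq) auto
    qed (use assms in auto)
    finally show ?thesis by (simp add: power_mult_distrib mult_ac)
  qed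
  moreover have "lam * V = lam * W + lam * (a * D\<^sup>2)" by (simp add: V_def algebra_simps)
  ultimately have "exp (- lam * V) \<le> 1 - lam * W" by linarith
  then show ?thesis by (simp add: V_def a_def)
qed

section \<open>Measurability of the feedback\<close>

text \<open>The derivative is the pointwise limit of difference quotients with step
  \<open>1 / (n + 1)\<close>, each jointly measurable. Joint measurability matters because the
  feedback evaluates the derivative at a random prediction.\<close>

lemma borel_measurable_deriv_real:
  fixes l :: "real \<Rightarrow> real \<Rightarrow> real"
  assumes [measurable]: "(\<lambda>(a, b). l a b) \<in> borel_measurable (borel \<Otimes>\<^sub>M borel)"
    and diff: "\<And>a b. (\<lambda>u. l u b) differentiable (at a)"
  shows "(\<lambda>(a, b). deriv (\<lambda>u. l u b) a) \<in> borel_measurable (borel \<Otimes>\<^sub>M borel)"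
proof (rule borel_measurable_LIMSEQ_real)
  define h where "h = (\<lambda>n. inverse (real (Suc n)))"
  define u where "u = (\<lambda>n (a, b). (l (a + h n) b - l a b) / h n)"
  show "u n \<in> borel_measurable (borel \<Otimes>\<^sub>M borel)" for n
    unfolding u_def by measurable
  fix z :: "real \<times> real"
  obtain a b where z: "z = (a, b)" by (cases z)
  have "DERIV (\<lambda>u. l u b) a :> deriv (\<lambda>u. l u b) a"
    using diff[where a = a and b = b] by (simp add: DERIV_deriv_iff_real_differentiable)
  then have "((\<lambda>h. (l (a + h) b - l a b) / h) \<longlongrightarrow> deriv (\<lambda>u. l u b) a) (at 0)"
    by (simp add: DERIV_def)
  moreover have "filterlim h (at 0) sequentially"
    unfolding h_def filterlim_at using LIMSEQ_inverse_real_of_nat by auto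
  ultimately have "(\<lambda>n. (l (a + h n) b - l a b) / h n) \<longlonglongrightarrow> deriv (\<lambda>u. l u b) a"
    by (rule filterlim_compose)
  then show "(\<lambda>n. u n z) \<longlonglongrightarrow> (case z of (a, b) \<Rightarrow> deriv (\<lambda>u. l u b) a)"
    by (simp add: u_def z)
qed

section \<open>Statistical setting: the law of one pair\<close>

text \<open>The assumptions concern only the law of one pair. The sample enters later, as a fixed
  sequence in pathwise facts and as random variables in distributional ones.\<close>

locale strongly_convex_experts = prob_space P
  for P :: "('x \<times> real) measure" +
  fixes N :: "'x measure" and l :: "real \<Rightarrow> real \<Rightarrow> real" and f :: "nat \<Rightarrow> 'x \<Rightarrow> real"
    and M \<mu> :: real and K :: nat
  assumes sets_P [measurable_cong]: "sets P = sets (N \<Otimes>\<^sub>M borel)"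
    and l_measurable [measurable]: "(\<lambda>(a, b). l a b) \<in> borel_measurable (borel \<Otimes>\<^sub>M borel)"
    and l_differentiable: "\<And>a b. (\<lambda>u. l u b) differentiable (at a)"
    and f_measurable: "\<And>i. i \<in> {1..K} \<Longrightarrow> f i \<in> borel_measurable N"
    and M_pos: "M > 0" and \<mu>_pos: "0 < \<mu>" and \<mu>_le: "\<mu> \<le> 2" and K_ge: "K \<ge> 1"
    and AE_f: "\<And>i. i \<in> {1..K} \<Longrightarrow> AE z in P. \<bar>f i (fst z)\<bar> \<le> M / 2"
    and AE_deriv: "AE z in P. \<forall>y. \<bar>y\<bar> \<le> M / 2 \<longrightarrow> \<bar>deriv (\<lambda>u. l u (snd z)) y\<bar> \<le> M"
    and AE_convex: "AE z in P. strongly_convex \<mu> M (\<lambda>u. l u (snd z))"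
begin

definition mix :: "(nat \<Rightarrow> real) \<Rightarrow> 'x \<times> real \<Rightarrow> real" where
  "mix q z = mixture K q (\<lambda>i. f i (fst z))"

definition mix_loss :: "(nat \<Rightarrow> real) \<Rightarrow> 'x \<times> real \<Rightarrow> real" where
  "mix_loss q z = l (mix q z) (snd z)"

definition mix_risk :: "(nat \<Rightarrow> real) \<Rightarrow> real" where
  "mix_risk q = risk P l (\<lambda>x. mixture K q (\<lambda>i. f i x))"

text \<open>The data are an explicit sequence, so the same weights serve for points of the product
  space and for sample paths.\<close>

definition weights :: "(nat \<Rightarrow> 'x \<times> real) \<Rightarrow> nat \<Rightarrow> nat \<Rightarrow> real" where
  "weights x = alg_weights (\<mu> / 4) M K (\<lambda>t i. f i (fst (x t)))
                 (\<lambda>t a. deriv (\<lambda>u. l u (snd (x t))) a)"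

text \<open>
  The deviation of the loss gap from its mean, corrected by the quadratic gain that strong
  convexity leaves in the regret bound.
\<close>

definition deviation :: "(nat \<Rightarrow> real) \<Rightarrow> (nat \<Rightarrow> real) \<Rightarrow> 'x \<times> real \<Rightarrow> real" where
  "deviation e q z = mix_risk q - mix_risk e
     - (mix_loss q z - mix_loss e z) - \<mu> / 4 * (mix q z - mix e z)\<^sup>2"

text \<open>Collecting the almost sure conditions at one data point lets a null set be discarded
  once; what follows is then pointwise.\<close>

definition regular :: "'x \<times> real \<Rightarrow> bool" where
  "regular z \<longleftrightarrow> (\<forall>i\<in>{1..K}. \<bar>f i (fst z)\<bar> \<le> M / 2) \<and>
     (\<forall>y. \<bar>y\<bar> \<le> M / 2 \<longrightarrow> \<bar>deriv (\<lambda>u. l u (snd z)) y\<bar> \<le> M) \<and>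
     strongly_convex \<mu> M (\<lambda>u. l u (snd z))"

lemma AE_regular: "AE z in P. regular z"
  unfolding regular_def using AE_f AE_deriv AE_convex
  by (intro AE_conjI AE_finite_allI) auto

lemma mix_risk_eq: "mix_risk q = (\<integral>z. mix_loss q z \<partial>P)"
  by (simp add: mix_risk_def risk_def mix_loss_def mix_def)

lemma abs_mix_le: "prob_vec K q \<Longrightarrow> regular z \<Longrightarrow> \<bar>mix q z\<bar> \<le> M / 2"
  unfolding mix_def by (rule abs_mixture_le) (auto simp: regular_def)

lemma abs_mix_diff_le: "prob_vec K q \<Longrightarrow> prob_vec K e \<Longrightarrow> regular z \<Longrightarrow> \<bar>mix q z - mix e z\<bar> \<le> M"
  using abs_mix_le[of q z] abs_mix_le[of e z] by auto

lemma abs_mix_loss_diff_le: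
  assumes "prob_vec K q" "prob_vec K e" "regular z"
  shows "\<bar>mix_loss q z - mix_loss e z\<bar> \<le> M * \<bar>mix q z - mix e z\<bar>"
  unfolding mix_loss_def
  by (rule strongly_convex_lipschitz[where \<mu> = \<mu> and M = M])
     (use assms \<mu>_pos abs_mix_le in \<open>auto simp: regular_def\<close>)

lemma abs_mix_loss_diff_le_square:
  assumes "prob_vec K q" "prob_vec K e" "regular z"
  shows "\<bar>mix_loss q z - mix_loss e z\<bar> \<le> M\<^sup>2"
proof -
  have "M * \<bar>mix q z - mix e z\<bar> \<le> M * M"
    using abs_mix_diff_le[OF assms] M_pos by (intro mult_left_mono) auto
  then show ?thesis using abs_mix_loss_diff_le[OF assms] by (simp add: power2_eq_square)
qed

section \<open>Measurability for random weights and data\<close>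

lemma measurable_fst_P [measurable (raw)]:
  assumes "Z \<in> measurable A P"
  shows "(\<lambda>\<omega>. fst (Z \<omega>)) \<in> measurable A N"
  using measurable_compose[OF assms, of fst N] by (simp add: measurable_cong_sets[OF sets_P refl])

lemma measurable_snd_P [measurable (raw)]:
  assumes "Z \<in> measurable A P"
  shows "(\<lambda>\<omega>. snd (Z \<omega>)) \<in> borel_measurable A"
  using measurable_compose[OF assms, of snd borel] by (simp add: measurable_cong_sets[OF sets_P refl])

lemma measurable_mix:
  assumes "\<And>i. i \<in> {1..K} \<Longrightarrow> (\<lambda>\<omega>. q \<omega> i) \<in> borel_measurable A"
    and [measurable]: "Z \<in> measurable A P"
  shows "(\<lambda>\<omega>. mix (q \<omega>) (Z \<omega>)) \<in> borel_measurable A"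
proof -
  have "(\<lambda>\<omega>. f i (fst (Z \<omega>))) \<in> borel_measurable A" if "i \<in> {1..K}" for i
    by (rule measurable_compose[OF measurable_fst_P f_measurable]) (use assms that in auto)
  then show ?thesis unfolding mix_def mixture_def
    using assms by (intro borel_measurable_sum borel_measurable_times) auto
qed

lemma measurable_mix_loss:
  assumes "\<And>i. i \<in> {1..K} \<Longrightarrow> (\<lambda>\<omega>. q \<omega> i) \<in> borel_measurable A"
    and [measurable]: "Z \<in> measurable A P"
  shows "(\<lambda>\<omega>. mix_loss (q \<omega>) (Z \<omega>)) \<in> borel_measurable A"
proof -
  note [measurable] = measurable_mix[OF assms]
  show ?thesis unfolding mix_loss_def by measurable
qed

text \<open>The risk of random weights is an integral with a parameter, so its measurability comes
  from joint measurability of the loss in the sample point and the fresh pair.\<close>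

lemma measurable_mix_risk:
  assumes "\<And>i. i \<in> {1..K} \<Longrightarrow> (\<lambda>\<omega>. q \<omega> i) \<in> borel_measurable A"
  shows "(\<lambda>\<omega>. mix_risk (q \<omega>)) \<in> borel_measurable A"
  unfolding mix_risk_eq
proof (rule borel_measurable_lebesgue_integral)
  have "(\<lambda>\<omega>. mix_loss (q (fst \<omega>)) (snd \<omega>)) \<in> borel_measurable (A \<Otimes>\<^sub>M P)"
    by (rule measurable_mix_loss) (use assms in \<open>auto intro: measurable_compose[OF measurable_fst]\<close>)
  then show "(\<lambda>(\<omega>, z). mix_loss (q \<omega>) z) \<in> borel_measurable (A \<Otimes>\<^sub>M P)"
    by (simp add: case_prod_beta')
qed

lemma measurable_mix_const [measurable]: "mix q \<in> borel_measurable P"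
  using measurable_mix[of "\<lambda>_. q" P "\<lambda>z. z"] by simp

lemma measurable_mix_loss_const [measurable]: "mix_loss q \<in> borel_measurable P"
  using measurable_mix_loss[of "\<lambda>_. q" P "\<lambda>z. z"] by simp

lemma measurable_deviation:
  assumes "\<And>i. i \<in> {1..K} \<Longrightarrow> (\<lambda>\<omega>. q \<omega> i) \<in> borel_measurable A"
    and [measurable]: "Z \<in> measurable A P"
  shows "(\<lambda>\<omega>. deviation e (q \<omega>) (Z \<omega>)) \<in> borel_measurable A"
proof -
  note [measurable] = measurable_mix[OF assms] measurable_mix_loss[OF assms]
    measurable_mix_risk[OF assms(1)]
  show ?thesis unfolding deviation_def by measurable
qed

text \<open>Induction over rounds: past losses determine the weights, these and the new features the
  prediction, and the feedback composes the jointly measurable derivative with prediction and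
  outcome.\<close>

lemma measurable_cum_loss:
  assumes Z: "\<And>s. s \<in> {1..t} \<Longrightarrow> Z s \<in> measurable A P" and "i \<in> {1..K}"
  shows "(\<lambda>\<omega>. cum_loss \<eta> M K (\<lambda>s i. f i (fst (Z s \<omega>))) (\<lambda>s a. deriv (\<lambda>u. l u (snd (Z s \<omega>))) a) t i)
           \<in> borel_measurable A"
  using assms
proof (induction t arbitrary: i)
  case 0
  then show ?case by simp
next
  case (Suc t)
  define L where "L = (\<lambda>\<omega>. cum_loss \<eta> M K (\<lambda>s i. f i (fst (Z s \<omega>))) (\<lambda>s a. deriv (\<lambda>u. l u (snd (Z s \<omega>))) a) t)"
  define a where "a = (\<lambda>\<omega>. mix (exp_weights K (L \<omega>)) (Z (Suc t) \<omega>))"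
  have [measurable]: "(\<lambda>\<omega>. L \<omega> j) \<in> borel_measurable A" if "j \<in> {1..K}" for j
    unfolding L_def using Suc.prems(1) that by (intro Suc.IH) auto
  have Zt [measurable]: "Z (Suc t) \<in> measurable A P" using Suc.prems(1) by simp
  have [measurable]: "(\<lambda>\<omega>. exp_weights K (L \<omega>) j) \<in> borel_measurable A" if "j \<in> {1..K}" for j
    unfolding exp_weights_def using that by measurable
  have [measurable]: "a \<in> borel_measurable A" unfolding a_def by (intro measurable_mix) auto
  have [measurable]: "(\<lambda>\<omega>. deriv (\<lambda>u. l u (snd (Z (Suc t) \<omega>))) (a \<omega>)) \<in> borel_measurable A"
  proof -
    have "(\<lambda>\<omega>. (a \<omega>, snd (Z (Suc t) \<omega>))) \<in> measurable A (borel \<Otimes>\<^sub>M borel)" by measurable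
    from measurable_compose[OF this borel_measurable_deriv_real[OF l_measurable l_differentiable]]
    show ?thesis by simp
  qed
  have [measurable]: "f i \<in> borel_measurable N" using f_measurable Suc.prems(2) .
  have "(\<lambda>\<omega>. L \<omega> i + surrogate_loss \<eta> M (f i (fst (Z (Suc t) \<omega>))) (a \<omega>)
           (deriv (\<lambda>u. l u (snd (Z (Suc t) \<omega>))) (a \<omega>))) \<in> borel_measurable A"
    unfolding surrogate_loss_def Let_def using Suc.prems(2) by measurable
  then show ?case by (simp add: Let_def L_def a_def mix_def)
qed

lemma measurable_weights:
  assumes "\<And>s. s \<in> {1..<t} \<Longrightarrow> Z s \<in> measurable A P" and "i \<in> {1..K}"
  shows "(\<lambda>\<omega>. weights (\<lambda>s. Z s \<omega>) t i) \<in> borel_measurable A"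
proof -
  define L where "L = (\<lambda>\<omega>. cum_loss (\<mu> / 4) M K (\<lambda>s i. f i (fst (Z s \<omega>)))
      (\<lambda>s a. deriv (\<lambda>u. l u (snd (Z s \<omega>))) a) (t - 1))"
  have [measurable]: "(\<lambda>\<omega>. L \<omega> j) \<in> borel_measurable A" if "j \<in> {1..K}" for j
    unfolding L_def by (rule measurable_cum_loss[OF assms(1) that]) auto
  have "(\<lambda>\<omega>. exp_weights K (L \<omega>) i) \<in> borel_measurable A"
    unfolding exp_weights_def using assms(2) by measurable
  then show ?thesis unfolding weights_def alg_weights_def L_def .
qed

lemma weights_cong: "(\<And>s. s \<in> {1..<t} \<Longrightarrow> x s = x' s) \<Longrightarrow> weights x t = weights x' t"
  unfolding weights_def by (rule alg_weights_cong) auto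

lemma prob_vec_weights: "prob_vec K (weights x t)"
  unfolding weights_def by (rule prob_vec_alg_weights[OF K_ge])

section \<open>Exponential moments of the deviation\<close>

lemma integrable_mix_loss_diff:
  assumes "prob_vec K q" "prob_vec K e"
  shows "integrable P (\<lambda>z. mix_loss q z - mix_loss e z)"
proof (rule integrable_const_bound)
  show "AE z in P. norm (mix_loss q z - mix_loss e z) \<le> M\<^sup>2"
    using AE_regular by eventually_elim (use assms abs_mix_loss_diff_le_square in auto)
qed measurable

text \<open>The losses of two mixtures differ by an almost surely bounded function, so either all
  mixtures have integrable loss or none has.\<close>

lemma integrable_mix_loss_transfer:
  assumes "prob_vec K q" "prob_vec K e" "integrable P (mix_loss e)"
  shows "integrable P (mix_loss q)"
  using Bochner_Integration.integrable_add[OF integrable_mix_loss_diff[OF assms(1,2)] assms(3)] by simp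

text \<open>By \<open>exp_loss_gap_le\<close> the integrand is almost surely at most
  \<open>exp (lam * d) * (1 - lam * W z)\<close>. Since \<open>W\<close> has mean \<open>d\<close>,
  this integrates to \<open>exp (lam * d) * (1 - lam * d)\<close>, which is at most 1.\<close>

lemma nn_integral_exp_deviation_le:
  assumes q: "prob_vec K q" and e: "prob_vec K e" and int: "integrable P (mix_loss e)"
    and lam: "lam > 0" "lam \<le> 1 / ((2 + \<mu> / 2) * M\<^sup>2)"
      "lam \<le> \<mu> / (6 * M\<^sup>2) * inverse (1 + \<mu>\<^sup>2 / 16)"
  shows "(\<integral>\<^sup>+z. ennreal (exp (lam * deviation e q z)) \<partial>P) \<le> 1"
proof -
  define W where "W = (\<lambda>z. mix_loss q z - mix_loss e z)"
  define d where "d = mix_risk q - mix_risk e"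
  have intW: "integrable P W" unfolding W_def by (rule integrable_mix_loss_diff[OF q e])
  have d: "(\<integral>z. W z \<partial>P) = d"
    unfolding W_def d_def mix_risk_eq
    by (rule Bochner_Integration.integral_diff[OF integrable_mix_loss_transfer[OF q e int] int])
  have bound: "AE z in P. exp (- lam * (W z + \<mu> / 4 * (mix q z - mix e z)\<^sup>2)) \<le> 1 - lam * W z"
    using AE_regular
    by eventually_elim
       (unfold W_def, rule exp_loss_gap_le[OF M_pos \<mu>_pos lam abs_mix_loss_diff_le[OF q e] abs_mix_diff_le[OF q e]])
  have "(\<integral>\<^sup>+z. ennreal (exp (lam * deviation e q z)) \<partial>P) \<le> (\<integral>\<^sup>+z. ennreal (exp (lam * d) * (1 - lam * W z)) \<partial>P)"
    using bound
  proof (intro nn_integral_mono_AE, eventually_elim)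
    fix z assume z: "exp (- lam * (W z + \<mu> / 4 * (mix q z - mix e z)\<^sup>2)) \<le> 1 - lam * W z"
    have "exp (lam * deviation e q z) = exp (lam * d) * exp (- lam * (W z + \<mu> / 4 * (mix q z - mix e z)\<^sup>2))"
      unfolding exp_add[symmetric] by (simp add: deviation_def W_def d_def algebra_simps)
    then show "ennreal (exp (lam * deviation e q z)) \<le> ennreal (exp (lam * d) * (1 - lam * W z))"
      using z by (intro ennreal_leI) simp
  qed
  also have "\<dots> = ennreal (\<integral>z. exp (lam * d) * (1 - lam * W z) \<partial>P)"
  proof (rule nn_integral_eq_integral)
    show "AE z in P. 0 \<le> exp (lam * d) * (1 - lam * W z)"
      using bound by eventually_elim (auto intro!: mult_nonneg_nonneg intro: order.trans[OF less_imp_le[OF exp_gt_zero]])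
  qed (use intW in auto)
  also have "(\<integral>z. exp (lam * d) * (1 - lam * W z) \<partial>P) = exp (lam * d) * (1 - lam * d)"
    using intW by (simp add: d prob_space)
  also have "\<dots> \<le> exp (lam * d) * exp (- (lam * d))"
    using exp_ge_add_one_self[of "- (lam * d)"] by (intro mult_left_mono) auto
  also have "\<dots> = 1" by (simp add: exp_add[symmetric])
  finally show ?thesis by (simp add: ennreal_leI)
qed

lemma measurable_path_deviation:
  assumes "\<And>s. s \<in> {1..t} \<Longrightarrow> Z s \<in> measurable A P" "t \<ge> 1"
  shows "(\<lambda>\<omega>. deviation e (weights (\<lambda>s. Z s \<omega>) t) (Z t \<omega>)) \<in> borel_measurable A"
  using assms by (intro measurable_deviation measurable_weights) auto

text \<open>Supermartingale argument: the last data point is integrated out first, its predecessors fixed.\<close>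

lemma nn_integral_exp_path_deviation_le:
  assumes e: "prob_vec K e" and int: "integrable P (mix_loss e)"
    and lam: "lam > 0" "lam \<le> 1 / ((2 + \<mu> / 2) * M\<^sup>2)"
      "lam \<le> \<mu> / (6 * M\<^sup>2) * inverse (1 + \<mu>\<^sup>2 / 16)"
  shows "(\<integral>\<^sup>+x. ennreal (exp (lam * (\<Sum>t=1..n. deviation e (weights x t) (x t)))) \<partial>Pi\<^sub>M {1..n} (\<lambda>_. P)) \<le> 1"
proof (induction n)
  case 0
  show ?case by (simp add: PiM_empty)
next
  case (Suc n)
  interpret product_sigma_finite "\<lambda>_::nat. P" ..
  define G where "G = (\<lambda>x. ennreal (exp (lam * (\<Sum>t=1..n. deviation e (weights x t) (x t)))))"
  define H where "H = (\<lambda>x. ennreal (exp (lam * (\<Sum>t=1..Suc n. deviation e (weights x t) (x t)))))"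
  have ins: "{1..Suc n} = insert (Suc n) {1..n}" by auto
  have H_meas: "H \<in> borel_measurable (Pi\<^sub>M (insert (Suc n) {1..n}) (\<lambda>_. P))"
  proof -
    have [measurable]: "(\<lambda>x. deviation e (weights x t) (x t)) \<in> borel_measurable (Pi\<^sub>M {1..Suc n} (\<lambda>_. P))"
      if "t \<in> {1..Suc n}" for t
      using measurable_path_deviation[of t "\<lambda>s x. x s" "Pi\<^sub>M {1..Suc n} (\<lambda>_. P)" e] that
      by (auto intro: measurable_component_singleton)
    show ?thesis unfolding H_def ins[symmetric] by measurable
  qed
  \<comment> \<open>Weights up to round \<open>Suc n\<close> read only earlier data, so overwriting
    the last point changes the last factor alone.\<close>
  have H_upd: "H (x(Suc n := y)) = G x * ennreal (exp (lam * deviation e (weights x (Suc n)) y))" for x y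
  proof -
    have "deviation e (weights (x(Suc n := y)) t) ((x(Suc n := y)) t) = deviation e (weights x t) (x t)"
      if "t \<in> {1..n}" for t
    proof -
      have "weights (x(Suc n := y)) t = weights x t" by (rule weights_cong) (use that in auto)
      then show ?thesis using that by simp
    qed
    moreover have "weights (x(Suc n := y)) (Suc n) = weights x (Suc n)" by (rule weights_cong) auto
    ultimately show ?thesis
      by (simp add: H_def G_def ennreal_mult'[symmetric] exp_add[symmetric] distrib_left)
  qed
  have "(\<integral>\<^sup>+x. H x \<partial>Pi\<^sub>M {1..Suc n} (\<lambda>_. P)) = (\<integral>\<^sup>+x. (\<integral>\<^sup>+y. H (x(Suc n := y)) \<partial>P) \<partial>Pi\<^sub>M {1..n} (\<lambda>_. P))"
    unfolding ins by (rule product_nn_integral_insert[OF _ _ H_meas]) auto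
  also have "\<dots> \<le> (\<integral>\<^sup>+x. G x \<partial>Pi\<^sub>M {1..n} (\<lambda>_. P))"
  proof (intro nn_integral_mono)
    fix x
    have [measurable]: "(\<lambda>z. deviation e (weights x (Suc n)) z) \<in> borel_measurable P"
      by (rule measurable_deviation) auto
    have "(\<integral>\<^sup>+y. H (x(Suc n := y)) \<partial>P) = G x * (\<integral>\<^sup>+y. ennreal (exp (lam * deviation e (weights x (Suc n)) y)) \<partial>P)"
      unfolding H_upd by (rule nn_integral_cmult) measurable
    also have "\<dots> \<le> G x * 1"
      by (intro mult_left_mono nn_integral_exp_deviation_le prob_vec_weights e int lam) auto
    finally show "(\<integral>\<^sup>+y. H (x(Suc n := y)) \<partial>P) \<le> G x" by simp
  qed
  also have "\<dots> \<le> 1" unfolding G_def by (rule Suc.IH)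
  finally show ?case unfolding H_def .
qed

section \<open>Convexity of the risk and pathwise regret\<close>

text \<open>Jensen's inequality holds at every regular point and is integrated over the fresh pair.
  It reduces the averaged predictor to the per-round risks.\<close>

lemma mix_risk_average_le:
  assumes "(T::nat) \<ge> 1" and q: "\<And>t. t \<in> {1..T} \<Longrightarrow> prob_vec K (q t)"
    and int: "\<And>q. prob_vec K q \<Longrightarrow> integrable P (mix_loss q)"
  shows "mix_risk (\<lambda>i. 1 / real T * (\<Sum>t=1..T. q t i)) \<le> 1 / real T * (\<Sum>t=1..T. mix_risk (q t))"
proof -
  define m where "m = (\<lambda>i. 1 / real T * (\<Sum>t=1..T. q t i))"
  have m: "prob_vec K m" unfolding m_def by (rule prob_vec_average[OF assms(1) q])
  have mix_m: "mix m z = 1 / real T * (\<Sum>t=1..T. mix (q t) z)" for z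
    unfolding mix_def m_def by (rule mixture_average)
  have "(\<integral>z. mix_loss m z \<partial>P) \<le> (\<integral>z. 1 / real T * (\<Sum>t=1..T. mix_loss (q t) z) \<partial>P)"
  proof (rule integral_mono_AE)
    show "AE z in P. mix_loss m z \<le> 1 / real T * (\<Sum>t=1..T. mix_loss (q t) z)"
      using AE_regular
    proof eventually_elim
      fix z assume z: "regular z"
      show "mix_loss m z \<le> 1 / real T * (\<Sum>t=1..T. mix_loss (q t) z)"
        unfolding mix_loss_def mix_m
        by (rule strongly_convex_average_le[where \<mu> = \<mu> and M = M])
           (use z \<mu>_pos assms(1) q abs_mix_le[OF _ z] abs_mix_le[OF m z, unfolded mix_m]
            in \<open>auto simp: regular_def\<close>)
    qed
  qed (use m q int in \<open>auto intro!: integrable_mult_right Bochner_Integration.integrable_sum\<close>)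
  also have "\<dots> = 1 / real T * (\<Sum>t=1..T. mix_risk (q t))"
    unfolding mix_risk_eq integral_mult_right_zero
    by (subst Bochner_Integration.integral_sum) (use q int in auto)
  finally show ?thesis unfolding mix_risk_eq m_def .
qed

text \<open>Strong convexity yields a gain of \<open>\<mu> / 2\<close> times the squared
  differences. The regret bound with step size \<open>\<mu> / 4\<close> spends half of it; the other
  half stays on the left as the correction used in \<open>deviation\<close>.\<close>

lemma path_regret_le:
  assumes x: "\<And>t. t \<in> {1..T} \<Longrightarrow> regular (x t)" and i: "i \<in> {1..K}"
  defines "e \<equiv> (\<lambda>j. if j = i then 1 else 0)"
  shows "(\<Sum>t=1..T. mix_loss (weights x t) (x t) - mix_loss e (x t) +
           \<mu> / 4 * (mix (weights x t) (x t) - mix e (x t))\<^sup>2) \<le> 4 * M\<^sup>2 * ln K / \<mu>"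
proof -
  define a where "a = (\<lambda>t. mix (weights x t) (x t))"
  define g where "g = (\<lambda>t u. deriv (\<lambda>u. l u (snd (x t))) u)"
  have a: "a = alg_prediction (\<mu> / 4) M K (\<lambda>t i. f i (fst (x t))) g"
    by (rule ext) (simp add: a_def alg_prediction_def mix_def weights_def g_def)
  have e: "prob_vec K e" unfolding e_def using i by (rule prob_vec_unit)
  have mix_e: "mix e z = f i (fst z)" for z
    unfolding mix_def e_def using i by (rule mixture_unit)
  \<comment> \<open>Here \<open>\<mu> \<le> 2\<close> supplies the step size condition
    \<open>\<mu> / 4 \<le> 1/2\<close>.\<close>
  have "(\<Sum>t=1..T. (a t - f i (fst (x t))) * g t (a t)) \<le>
      M\<^sup>2 * ln K / (\<mu> / 4) + \<mu> / 4 * (\<Sum>t=1..T. (a t - f i (fst (x t)))\<^sup>2)"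
    unfolding a
    by (rule linear_regret_le[OF K_ge _ _ M_pos i])
       (use \<mu>_pos \<mu>_le x in \<open>auto simp: regular_def g_def\<close>)
  moreover have "(\<Sum>t=1..T. mix_loss (weights x t) (x t) - mix_loss e (x t) + \<mu> / 4 * (a t - f i (fst (x t)))\<^sup>2)
      \<le> (\<Sum>t=1..T. (a t - f i (fst (x t))) * g t (a t) - \<mu> / 4 * (a t - f i (fst (x t)))\<^sup>2)"
  proof (intro sum_mono)
    fix t assume "t \<in> {1..T}"
    then have r: "regular (x t)" by (rule x)
    have "mix_loss (weights x t) (x t) - mix_loss e (x t) \<le>
        (a t - f i (fst (x t))) * g t (a t) - \<mu> / 2 * (f i (fst (x t)) - a t)\<^sup>2"
      unfolding mix_loss_def a_def g_def mix_e
      by (rule strongly_convexD)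
         (use r i abs_mix_le[OF prob_vec_weights r] in \<open>auto simp: regular_def\<close>)
    then show "mix_loss (weights x t) (x t) - mix_loss e (x t) + \<mu> / 4 * (a t - f i (fst (x t)))\<^sup>2
      \<le> (a t - f i (fst (x t))) * g t (a t) - \<mu> / 4 * (a t - f i (fst (x t)))\<^sup>2"
      by (simp add: power2_commute)
  qed
  moreover have "(\<Sum>t=1..T. (a t - f i (fst (x t))) * g t (a t) - \<mu> / 4 * (a t - f i (fst (x t)))\<^sup>2) =
      (\<Sum>t=1..T. (a t - f i (fst (x t))) * g t (a t)) - \<mu> / 4 * (\<Sum>t=1..T. (a t - f i (fst (x t)))\<^sup>2)"
    by (simp only: sum_subtractf sum_distrib_left)
  ultimately have "(\<Sum>t=1..T. mix_loss (weights x t) (x t) - mix_loss e (x t) + \<mu> / 4 * (a t - f i (fst (x t)))\<^sup>2)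
      \<le> M\<^sup>2 * ln K / (\<mu> / 4)"
    by argo
  then show ?thesis by (simp add: mix_e a_def mult_ac)
qed

section \<open>From exponential moments to high probability\<close>

text \<open>Independence and equal laws make the joint law of the sample a product measure, which
  carries the moment bound over to \<open>S\<close>. Markov's inequality then bounds the
  complementary event by \<open>\<delta>\<close>.\<close>

lemma prob_path_deviation_ge:
  fixes S :: "'w measure" and Z :: "nat \<Rightarrow> 'w \<Rightarrow> 'x \<times> real"
  assumes S: "prob_space S"
    and indep: "prob_space.indep_vars S (\<lambda>_. N \<Otimes>\<^sub>M borel) Z {1..T}"
    and distr: "\<And>t. t \<in> {1..T} \<Longrightarrow> distr S (N \<Otimes>\<^sub>M borel) (Z t) = P"
    and "T \<ge> 1" and e: "prob_vec K e" and int: "integrable P (mix_loss e)"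
    and lam: "lam > 0" "lam \<le> 1 / ((2 + \<mu> / 2) * M\<^sup>2)"
      "lam \<le> \<mu> / (6 * M\<^sup>2) * inverse (1 + \<mu>\<^sup>2 / 16)"
    and \<delta>: "\<delta> > 0"
  shows "measure S {\<omega> \<in> space S. (\<Sum>t=1..T. deviation e (weights (\<lambda>s. Z s \<omega>) t) (Z t \<omega>))
           \<le> ln (1 / \<delta>) / lam} \<ge> 1 - \<delta>"
proof -
  interpret S: prob_space S by fact
  define D where "D = (\<lambda>x. \<Sum>t=1..T. deviation e (weights x t) (x t))"
  have Z0: "Z t \<in> measurable S (N \<Otimes>\<^sub>M borel)" if "t \<in> {1..T}" for t
    using indep that unfolding S.indep_vars_def by auto
  have Z: "Z t \<in> measurable S P" if "t \<in> {1..T}" for t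
    using Z0[OF that] by (simp add: measurable_cong_sets[OF refl sets_P])
  have D_meas [measurable]: "(\<lambda>\<omega>. D (\<lambda>s. Z s \<omega>)) \<in> borel_measurable S"
    unfolding D_def using Z by (intro borel_measurable_sum measurable_path_deviation) auto
  have "distr S (Pi\<^sub>M {1..T} (\<lambda>_. N \<Otimes>\<^sub>M borel)) (\<lambda>\<omega>. \<lambda>t\<in>{1..T}. Z t \<omega>) =
      Pi\<^sub>M {1..T} (\<lambda>t. distr S (N \<Otimes>\<^sub>M borel) (Z t))"
    using S.indep_vars_iff_distr_eq_PiM'[of "{1..T}" Z "\<lambda>_. N \<Otimes>\<^sub>M borel"] Z0 indep \<open>T \<ge> 1\<close> by simp
  also have "\<dots> = Pi\<^sub>M {1..T} (\<lambda>_. P)" by (intro PiM_cong refl distr)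
  \<comment> \<open>\<open>P\<close> and \<open>N \<Otimes>\<^sub>M borel\<close> are different
    measures on the same sigma-algebra, and only the latter matters for the target of
    \<open>distr\<close>.\<close>
  also have "distr S (Pi\<^sub>M {1..T} (\<lambda>_. N \<Otimes>\<^sub>M borel)) (\<lambda>\<omega>. \<lambda>t\<in>{1..T}. Z t \<omega>) =
      distr S (Pi\<^sub>M {1..T} (\<lambda>_. P)) (\<lambda>\<omega>. \<lambda>t\<in>{1..T}. Z t \<omega>)"
    by (intro distr_cong refl sets_PiM_cong sets_P[symmetric])
  finally have law: "distr S (Pi\<^sub>M {1..T} (\<lambda>_. P)) (\<lambda>\<omega>. \<lambda>t\<in>{1..T}. Z t \<omega>) = Pi\<^sub>M {1..T} (\<lambda>_. P)" .
  \<comment> \<open>A point of the product space is undefined outside \<open>{1..T}\<close>, but the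
    weights of these rounds never look there.\<close>
  have D_restrict: "D (\<lambda>t\<in>{1..T}. Z t \<omega>) = D (\<lambda>s. Z s \<omega>)" for \<omega>
    unfolding D_def
  proof (intro sum.cong refl)
    fix t assume t: "t \<in> {1..T}"
    have "weights (\<lambda>t\<in>{1..T}. Z t \<omega>) t = weights (\<lambda>s. Z s \<omega>) t"
      by (rule weights_cong) (use t in auto)
    then show "deviation e (weights (\<lambda>t\<in>{1..T}. Z t \<omega>) t) ((\<lambda>t\<in>{1..T}. Z t \<omega>) t) =
        deviation e (weights (\<lambda>s. Z s \<omega>) t) (Z t \<omega>)"
      using t by simp
  qed
  have "(\<lambda>x. D x) \<in> borel_measurable (Pi\<^sub>M {1..T} (\<lambda>_. P))"
    unfolding D_def
    by (intro borel_measurable_sum measurable_path_deviation) (auto intro: measurable_component_singleton)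
  then have "(\<integral>\<^sup>+x. ennreal (exp (lam * D x)) \<partial>distr S (Pi\<^sub>M {1..T} (\<lambda>_. P)) (\<lambda>\<omega>. \<lambda>t\<in>{1..T}. Z t \<omega>))
      = (\<integral>\<^sup>+\<omega>. ennreal (exp (lam * D (\<lambda>s. Z s \<omega>))) \<partial>S)"
    using Z by (subst nn_integral_distr) (auto intro!: measurable_restrict simp: D_restrict simp del: One_nat_def)
  then have mgf: "(\<integral>\<^sup>+\<omega>. ennreal (exp (lam * D (\<lambda>s. Z s \<omega>))) \<partial>S) \<le> 1"
    unfolding law using nn_integral_exp_path_deviation_le[OF e int lam, of T] by (simp add: D_def)
  \<comment> \<open>Markov's inequality with multiplier \<open>\<delta>\<close>, that is, with
    threshold \<open>1 / \<delta>\<close> for the exponential.\<close>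
  have "emeasure S {\<omega> \<in> space S. 1 \<le> ennreal \<delta> * ennreal (exp (lam * D (\<lambda>s. Z s \<omega>)))}
      \<le> ennreal \<delta> * (\<integral>\<^sup>+\<omega>. ennreal (exp (lam * D (\<lambda>s. Z s \<omega>))) * indicator (space S) \<omega> \<partial>S)"
    by (rule nn_integral_Markov_inequality) auto
  also have "\<dots> = ennreal \<delta> * (\<integral>\<^sup>+\<omega>. ennreal (exp (lam * D (\<lambda>s. Z s \<omega>))) \<partial>S)"
    by (intro arg_cong2[of _ _ _ _ "(*)"] refl nn_integral_cong) auto
  also have "\<dots> \<le> ennreal \<delta> * 1" using mgf by (intro mult_left_mono) auto
  finally have "measure S {\<omega> \<in> space S. 1 \<le> ennreal \<delta> * ennreal (exp (lam * D (\<lambda>s. Z s \<omega>)))} \<le> \<delta>"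
    using \<delta> by (simp add: S.emeasure_eq_measure)
  moreover have "1 \<le> ennreal \<delta> * ennreal (exp (lam * D (\<lambda>s. Z s \<omega>)))"
    if "\<not> D (\<lambda>s. Z s \<omega>) \<le> ln (1 / \<delta>) / lam" for \<omega>
  proof -
    have "ln (1 / \<delta>) \<le> lam * D (\<lambda>s. Z s \<omega>)" using that lam(1) by (simp add: field_simps)
    then have "exp (ln (1 / \<delta>)) \<le> exp (lam * D (\<lambda>s. Z s \<omega>))" by (simp only: exp_le_cancel_iff)
    then have "1 / \<delta> \<le> exp (lam * D (\<lambda>s. Z s \<omega>))" using \<delta> by (simp only: exp_ln divide_pos_pos zero_less_one)
    then have "1 \<le> \<delta> * exp (lam * D (\<lambda>s. Z s \<omega>))" using \<delta> by (simp add: field_simps)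
    then show ?thesis using \<delta> by (simp add: ennreal_mult'[symmetric])
  qed
  then have "measure S (space S - {\<omega> \<in> space S. D (\<lambda>s. Z s \<omega>) \<le> ln (1 / \<delta>) / lam}) \<le>
      measure S {\<omega> \<in> space S. 1 \<le> ennreal \<delta> * ennreal (exp (lam * D (\<lambda>s. Z s \<omega>)))}"
    by (intro S.finite_measure_mono) auto
  ultimately have "measure S {\<omega> \<in> space S. D (\<lambda>s. Z s \<omega>) \<le> ln (1 / \<delta>) / lam} \<ge> 1 - \<delta>"
    by (subst (asm) S.prob_compl) auto
  then show ?thesis by (simp only: D_def)
qed

end

section \<open>Risk bound for the averaged predictor\<close>

theorem theorem18:
  fixes S :: "'w measure" and N :: "'x measure" and P :: "('x \<times> real) measure"
    and X :: "nat \<Rightarrow> 'w \<Rightarrow> 'x" and Y :: "nat \<Rightarrow> 'w \<Rightarrow> real"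
    and l :: "real \<Rightarrow> real \<Rightarrow> real" and f :: "nat \<Rightarrow> 'x \<Rightarrow> real"
    and M \<mu> \<delta> :: real and T K :: nat
    and p :: "'w \<Rightarrow> nat \<Rightarrow> nat \<Rightarrow> real" and fhat :: "'w \<Rightarrow> 'x \<Rightarrow> real"
  assumes "prob_space S" and "prob_space P"
    and "prob_space.indep_vars S (\<lambda>_. N \<Otimes>\<^sub>M borel) (\<lambda>t \<omega>. (X t \<omega>, Y t \<omega>)) {1..T}"
    and "\<And>t. t \<in> {1..T} \<Longrightarrow> distr S (N \<Otimes>\<^sub>M borel) (\<lambda>\<omega>. (X t \<omega>, Y t \<omega>)) = P"
    and "(\<lambda>(a, b). l a b) \<in> borel_measurable (borel \<Otimes>\<^sub>M borel)"
    and "\<And>a b. (\<lambda>u. l u b) differentiable (at a)"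
    and "\<And>i. i \<in> {1..K} \<Longrightarrow> f i \<in> borel_measurable N"
    and "M > 0" and "0 < \<mu>" and "\<mu> \<le> 2" and "T \<ge> 1" and "K \<ge> 1" and "0 < \<delta>" and "\<delta> < 1"
    and "\<And>i. i \<in> {1..K} \<Longrightarrow> AE z in P. \<bar>f i (fst z)\<bar> \<le> M / 2"
    and "AE z in P. \<forall>y. \<bar>y\<bar> \<le> M / 2 \<longrightarrow> \<bar>deriv (\<lambda>u. l u (snd z)) y\<bar> \<le> M"
    and "AE z in P. strongly_convex \<mu> M (\<lambda>u. l u (snd z))"
    and "\<And>\<omega>. p \<omega> = alg_weights (\<mu> / 4) M K (\<lambda>t i. f i (X t \<omega>))
                     (\<lambda>t a. deriv (\<lambda>u. l u (Y t \<omega>)) a)"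
    and "\<And>\<omega>. fhat \<omega> = averaged_predictor T K (p \<omega>) f"
  shows "measure S {\<omega> \<in> space S.
           risk P l (fhat \<omega>) - Min ((\<lambda>i. risk P l (f i)) ` {1..K})
             \<le> 1 / real T *
               (4 * M\<^sup>2 * ln (real K) / \<mu>
                + ln (1 / \<delta>) *
                  inverse (min (1 / ((2 + \<mu> / 2) * M\<^sup>2))
                               (\<mu> / (6 * M\<^sup>2) * inverse (1 + \<mu>\<^sup>2 / 16))))}
         \<ge> 1 - \<delta>"
proof -
  define lam where "lam = min (1 / ((2 + \<mu> / 2) * M\<^sup>2)) (\<mu> / (6 * M\<^sup>2) * inverse (1 + \<mu>\<^sup>2 / 16))"
  define B where "B = 1 / real T * (4 * M\<^sup>2 * ln (real K) / \<mu> + ln (1 / \<delta>) * inverse lam)"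
  define Z where "Z = (\<lambda>t \<omega>. (X t \<omega>, Y t \<omega>))"
  interpret S: prob_space S by fact
  have indep: "S.indep_vars (\<lambda>_. N \<Otimes>\<^sub>M borel) Z {1..T}" using assms(3) by (simp add: Z_def)
  have distr: "distr S (N \<Otimes>\<^sub>M borel) (Z t) = P" if "t \<in> {1..T}" for t
    using assms(4)[OF that] by (simp add: Z_def)
  have sets_P: "sets P = sets (N \<Otimes>\<^sub>M borel)" 
    using distr[of 1] \<open>T \<ge> 1\<close> by (metis atLeastAtMost_iff order_refl sets_distr)
  interpret strongly_convex_experts P N l f M \<mu> K
    by (intro strongly_convex_experts.intro strongly_convex_experts_axioms.intro assms(2) sets_P assms)
  have Z0: "Z t \<in> measurable S (N \<Otimes>\<^sub>M borel)" if "t \<in> {1..T}" for t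
    using indep that unfolding S.indep_vars_def by auto
  have Z: "Z t \<in> measurable S P" if "t \<in> {1..T}" for t
    using Z0[OF that] by (simp add: measurable_cong_sets[OF refl sets_P])
  have p: "p \<omega> = weights (\<lambda>s. Z s \<omega>)" for \<omega>
    by (simp add: assms(18) weights_def Z_def)
  define m where "m = (\<lambda>\<omega> i. 1 / real T * (\<Sum>t=1..T. weights (\<lambda>s. Z s \<omega>) t i))"
  have m: "prob_vec K (m \<omega>)" for \<omega>
    unfolding m_def by (rule prob_vec_average[OF \<open>T \<ge> 1\<close> prob_vec_weights])
  have risk_fhat: "risk P l (fhat \<omega>) = mix_risk (m \<omega>)" for \<omega>
    by (simp add: assms(19) p mix_risk_def averaged_predictor_eq_mixture m_def risk_def)
  define u where "u = (\<lambda>i j :: nat. if j = i then 1 else 0 :: real)"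
  have u: "prob_vec K (u i)" and risk_f: "risk P l (f i) = mix_risk (u i)" if "i \<in> {1..K}" for i
    unfolding u_def using prob_vec_unit[OF that] mixture_unit[OF that] by (auto simp: mix_risk_def)
  \<comment> \<open>The minimizer \<open>k\<close> does not depend on the sample, so the deviation
    bound is applied to one competitor only and the confidence term is free of
    \<open>K\<close>.\<close>
  have "Min ((\<lambda>i. risk P l (f i)) ` {1..K}) \<in> (\<lambda>i. risk P l (f i)) ` {1..K}"
    using \<open>K \<ge> 1\<close> by (intro Min_in) auto
  then obtain k where k: "k \<in> {1..K}" and Min: "Min ((\<lambda>i. risk P l (f i)) ` {1..K}) = mix_risk (u k)"
    using risk_f by auto
  have lam: "lam > 0" unfolding lam_def using \<open>M > 0\<close> \<open>0 < \<mu>\<close> 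
    by (auto intro!: mult_pos_pos divide_pos_pos add_pos_nonneg positive_imp_inverse_positive)
  have "1 - \<delta> \<le> measure S {\<omega> \<in> space S. mix_risk (m \<omega>) - mix_risk (u k) \<le> B}"
  proof (cases "integrable P (mix_loss (u k))")
    case False
    text \<open>All risks are Bochner integrals of non-integrable functions, hence 0.\<close>
    have "mix_risk q = 0" if "prob_vec K q" for q
    proof -
      have "\<not> integrable P (mix_loss q)"
        using False integrable_mix_loss_transfer[OF u[OF k] that] by blast
      then show ?thesis unfolding mix_risk_eq by (rule not_integrable_integral_eq)
    qed
    \<comment> \<open>Since \<open>\<delta> < 1\<close>, the logarithm in \<open>B\<close> is
      positive; the event is then the whole space.\<close>
    moreover have "B \<ge> 0" unfolding B_def
      using lam \<open>M > 0\<close> \<open>0 < \<mu>\<close> \<open>K \<ge> 1\<close> \<open>T \<ge> 1\<close> \<open>0 < \<delta>\<close> \<open>\<delta> < 1\<close>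
      by (intro mult_nonneg_nonneg add_nonneg_nonneg divide_nonneg_pos) auto
    ultimately show ?thesis using m u[OF k] \<open>0 < \<delta>\<close> by (simp add: S.prob_space)
  next
    case True
    then have int: "integrable P (mix_loss q)" if "prob_vec K q" for q
      using integrable_mix_loss_transfer[OF that u[OF k]] by blast
    have "1 - \<delta> \<le> measure S {\<omega> \<in> space S.
        (\<Sum>t=1..T. deviation (u k) (weights (\<lambda>s. Z s \<omega>) t) (Z t \<omega>)) \<le> ln (1 / \<delta>) / lam}"
      by (rule prob_path_deviation_ge[OF \<open>prob_space S\<close> indep distr \<open>T \<ge> 1\<close> u[OF k] True lam _ _ \<open>0 < \<delta>\<close>])
         (auto simp: lam_def)
    also have "\<dots> \<le> measure S {\<omega> \<in> space S. mix_risk (m \<omega>) - mix_risk (u k) \<le> B}"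
    \<comment> \<open>Once all data points are regular, the inclusion of the two events is
      deterministic.\<close>
    proof (rule S.finite_measure_mono_AE)
      have "(\<lambda>\<omega>. mix_risk (m \<omega>)) \<in> borel_measurable S"
        unfolding m_def
        by (intro measurable_mix_risk borel_measurable_times borel_measurable_sum measurable_weights)
           (use Z in auto)
      then show "{\<omega> \<in> space S. mix_risk (m \<omega>) - mix_risk (u k) \<le> B} \<in> sets S" by measurable
      have "AE \<omega> in S. \<forall>t\<in>{1..T}. regular (Z t \<omega>)"
      proof (rule AE_finite_allI)
        fix t assume t: "t \<in> {1..T}"
        show "AE \<omega> in S. regular (Z t \<omega>)"
          by (rule AE_distrD[OF Z0[OF t]], subst distr[OF t]) (rule AE_regular)
      qed simp
      then show "AE \<omega> in S. \<omega> \<in> {\<omega> \<in> space S.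
          (\<Sum>t=1..T. deviation (u k) (weights (\<lambda>s. Z s \<omega>) t) (Z t \<omega>)) \<le> ln (1 / \<delta>) / lam} \<longrightarrow>
          \<omega> \<in> {\<omega> \<in> space S. mix_risk (m \<omega>) - mix_risk (u k) \<le> B}"
      proof eventually_elim
        fix \<omega> assume reg: "\<forall>t\<in>{1..T}. regular (Z t \<omega>)"
        define q where "q = weights (\<lambda>s. Z s \<omega>)"
        have "mix_risk (m \<omega>) \<le> 1 / real T * (\<Sum>t=1..T. mix_risk (q t))"
          unfolding m_def q_def by (rule mix_risk_average_le[OF \<open>T \<ge> 1\<close> prob_vec_weights int])
        then have "mix_risk (m \<omega>) - mix_risk (u k) \<le> 1 / real T * (\<Sum>t=1..T. mix_risk (q t) - mix_risk (u k))"
          using \<open>T \<ge> 1\<close> by (simp add: sum_subtractf right_diff_distrib diff_divide_distrib)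
        \<comment> \<open>By the choice of \<open>deviation\<close>, each risk gap splits into a
          part bounded pathwise by the regret and a part bounded with high probability.\<close>
        also have "(\<Sum>t=1..T. mix_risk (q t) - mix_risk (u k)) =
            (\<Sum>t=1..T. mix_loss (q t) (Z t \<omega>) - mix_loss (u k) (Z t \<omega>) +
               \<mu> / 4 * (mix (q t) (Z t \<omega>) - mix (u k) (Z t \<omega>))\<^sup>2) +
            (\<Sum>t=1..T. deviation (u k) (q t) (Z t \<omega>))"
          unfolding sum.distrib[symmetric] by (intro sum.cong) (auto simp: deviation_def)
        also have "(\<Sum>t=1..T. mix_loss (q t) (Z t \<omega>) - mix_loss (u k) (Z t \<omega>) +
               \<mu> / 4 * (mix (q t) (Z t \<omega>) - mix (u k) (Z t \<omega>))\<^sup>2) \<le> 4 * M\<^sup>2 * ln (real K) / \<mu>"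
          unfolding q_def u_def using path_regret_le[of T "\<lambda>s. Z s \<omega>" k] reg k by blast
        finally have "mix_risk (m \<omega>) - mix_risk (u k) \<le>
            1 / real T * (4 * M\<^sup>2 * ln (real K) / \<mu> + (\<Sum>t=1..T. deviation (u k) (q t) (Z t \<omega>)))"
          using \<open>T \<ge> 1\<close> by (simp add: divide_right_mono)
        also have "\<dots> \<le> B" if "(\<Sum>t=1..T. deviation (u k) (q t) (Z t \<omega>)) \<le> ln (1 / \<delta>) / lam"
          unfolding B_def using that by (intro mult_left_mono) (auto simp: divide_inverse)
        finally show "\<omega> \<in> {\<omega> \<in> space S.
            (\<Sum>t=1..T. deviation (u k) (weights (\<lambda>s. Z s \<omega>) t) (Z t \<omega>)) \<le> ln (1 / \<delta>) / lam} \<longrightarrow>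
            \<omega> \<in> {\<omega> \<in> space S. mix_risk (m \<omega>) - mix_risk (u k) \<le> B}"
          by (auto simp: q_def)
      qed
    qed
    finally show ?thesis .
  qed
  then show ?thesis unfolding B_def lam_def risk_fhat Min .
qed

end
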